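(* Let $G_n^{0,q}$ be a $(0,q)$-perturbed noisy random geometric graph in the standard setting described in the context, and suppose that $n^{-\epsilon}\ll nr^d\ll\log n$ for all $\epsilon>0$. Then: (a) There exist constants $C_1,C_2>0$ depending on $\beta$ such that if $q\le C_1\,(nr^d/\log n)^{C_2}$, then there is a constant $C$ such that with high probability every long-edge $(u,v)$ of $G_n^{0,q}$ satisfies $$\omega_{u,v}(G_n^{0,q})\le C\,\frac{\log n}{\log(\log n/(nr^d))}.$$ (b) There exists a constant $\xi>0$ depending on $\beta$ such that if $(nr^d/\log n)^{\xi}\le q<1$, then there is a constant $C$ such that with high probability every long-edge $(u,v)$ of $G_n^{0,q}$ satisfies $\omega_{u,v}(G_n^{0,q})\le C\log_{1/q}n$.
   Context: Standard setting: fix an integer $d\ge 1$ and an arbitrary norm $\|\cdot\|$ on $\mathbb{R}^d$. Let $\nu$ be a probability distribution on $\mathbb{R}^d$ with a bounded density. Let $X_1,X_2,\dots$ be i.i.d. with law $\nu$, and let $r=r(n)>0$ with $r(n)\to 0$. $G_n$ is the random geometric graph on $\{X_1,\dots,X_n\}$ in which distinct $X_i,X_j$ are adjacent iff $\|X_i-X_j\|\le r(n)$. $G_n^{0,q}$ is obtained from $G_n$ by inserting each non-edge of $G_n$ independently with probability $q=q(n)$. $f\ll g$ means $f(n)/g(n)\to 0$. A long-edge of $G_n^{0,q}$ is an edge $(u,v)$ with $\|u-v\|>3r$. The edge clique number $\omega_{u,v}(G)$ is the largest size of a clique in $G$ containing both $u$ and $v$. "With high probability" means with probability tending to $1$. Besicovitch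 constant: a $\delta$-packing with respect to $P\subseteq\mathbb{R}^d$ is a countable collection of pairwise disjoint closed balls of radius $\delta$ centered at points of $P$; $\beta=\beta(d)\in\mathbb{N}$ is a constant such that for every $P\subseteq\mathbb{R}^d$ and $\delta>0$ there are $\beta$ $\delta$-packings with respect to $P$ whose union covers $P$. *)

theory Defs
  imports "HOL-Probability.Probability" "HOL-Library.Ramsey" "HOL-Library.Disjoint_Sets"
begin

(* The dimension d is a term rather than a type, because the constants of the theorem are
   chosen before d. So R^d is the set of extensional functions {..<d} -> real, which is also
   the space of the product measure leb d below. *)

definition Rd :: "nat \<Rightarrow> (nat \<Rightarrow> real) set" where
  "Rd d = ({..<d} \<rightarrow>\<^sub>E UNIV)"

definition vadd :: "nat \<Rightarrow> (nat \<Rightarrow> real) \<Rightarrow> (nat \<Rightarrow> real) \<Rightarrow> nat \<Rightarrow> real" where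
  "vadd d x y = (\<lambda>k\<in>{..<d}. x k + y k)"

definition vdiff :: "nat \<Rightarrow> (nat \<Rightarrow> real) \<Rightarrow> (nat \<Rightarrow> real) \<Rightarrow> nat \<Rightarrow> real" where
  "vdiff d x y = (\<lambda>k\<in>{..<d}. x k - y k)"

definition vscale :: "nat \<Rightarrow> real \<Rightarrow> (nat \<Rightarrow> real) \<Rightarrow> nat \<Rightarrow> real" where
  "vscale d a x = (\<lambda>k\<in>{..<d}. a * x k)"

definition is_norm :: "nat \<Rightarrow> ((nat \<Rightarrow> real) \<Rightarrow> real) \<Rightarrow> bool" where
  "is_norm d N \<longleftrightarrow>
     (\<forall>x\<in>Rd d. 0 \<le> N x) \<and>
     (\<forall>x\<in>Rd d. N x = 0 \<longleftrightarrow> x = (\<lambda>k\<in>{..<d}. 0)) \<and>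
     (\<forall>a. \<forall>x\<in>Rd d. N (vscale d a x) = \<bar>a\<bar> * N x) \<and>
     (\<forall>x\<in>Rd d. \<forall>y\<in>Rd d. N (vadd d x y) \<le> N x + N y)"

definition leb :: "nat \<Rightarrow> (nat \<Rightarrow> real) measure" where
  "leb d = Pi\<^sub>M {..<d} (\<lambda>_. lborel)"

definition has_bounded_density :: "nat \<Rightarrow> (nat \<Rightarrow> real) measure \<Rightarrow> bool" where
  "has_bounded_density d \<nu> \<longleftrightarrow>
     (\<exists>f c. f \<in> borel_measurable (leb d) \<and> (\<forall>x\<in>Rd d. 0 \<le> f x \<and> f x \<le> c) \<and>
            \<nu> = density (leb d) (\<lambda>x. ennreal (f x)))"

definition closed_ball ::
  "nat \<Rightarrow> ((nat \<Rightarrow> real) \<Rightarrow> real) \<Rightarrow> (nat \<Rightarrow> real) \<Rightarrow> real \<Rightarrow> (nat \<Rightarrow> real) set" where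
  "closed_ball d N p \<delta> = {x \<in> Rd d. N (vdiff d x p) \<le> \<delta>}"

definition packing ::
  "nat \<Rightarrow> ((nat \<Rightarrow> real) \<Rightarrow> real) \<Rightarrow> real \<Rightarrow> (nat \<Rightarrow> real) set \<Rightarrow> (nat \<Rightarrow> real) set set \<Rightarrow> bool" where
  "packing d N \<delta> P \<B> \<longleftrightarrow>
     countable \<B> \<and> disjoint \<B> \<and> (\<forall>B\<in>\<B>. \<exists>p\<in>P. B = closed_ball d N p \<delta>)"

definition besicovitch_constant :: "nat \<Rightarrow> ((nat \<Rightarrow> real) \<Rightarrow> real) \<Rightarrow> nat \<Rightarrow> bool" where
  "besicovitch_constant d N \<beta> \<longleftrightarrow>
     (\<forall>P \<delta>. P \<subseteq> Rd d \<and> \<delta> > 0 \<longrightarrow>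
        (\<exists>\<P>. (\<forall>i<\<beta>. packing d N \<delta> P (\<P> i)) \<and> P \<subseteq> (\<Union>i<\<beta>. \<Union>(\<P> i))))"

(* Graphs have vertex set {..<n}, vertex i standing for the i-th sample point x i, and are given
   by their sets of two-element edges. Since the law of the points has a density, the points are
   almost surely distinct, so this is almost surely the graph on the set of points. *)

definition rgg ::
  "nat \<Rightarrow> ((nat \<Rightarrow> real) \<Rightarrow> real) \<Rightarrow> real \<Rightarrow> nat \<Rightarrow> (nat \<Rightarrow> nat \<Rightarrow> real) \<Rightarrow> nat set set" where
  "rgg d N r n x = {{i, j} | i j. i < n \<and> j < n \<and> i \<noteq> j \<and> N (vdiff d (x i) (x j)) \<le> r}"

(* b e is the coin of the pair e; only the coins of non-edges of the geometric graph matter. *)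

definition perturbed_rgg ::
  "nat \<Rightarrow> ((nat \<Rightarrow> real) \<Rightarrow> real) \<Rightarrow> real \<Rightarrow> nat \<Rightarrow>
     (nat \<Rightarrow> nat \<Rightarrow> real) \<times> (nat set \<Rightarrow> bool) \<Rightarrow> nat set set" where
  "perturbed_rgg d N r n =
     (\<lambda>(x, b). rgg d N r n x \<union> {e \<in> nsets {..<n} 2 - rgg d N r n x. b e})"

(* The joint law of n independent points with law \<nu> and of independent coins with bias q,
   one for each pair of vertices, which are independent of the points. *)

definition perturbed_space ::
  "(nat \<Rightarrow> real) measure \<Rightarrow> real \<Rightarrow> nat \<Rightarrow>
     ((nat \<Rightarrow> nat \<Rightarrow> real) \<times> (nat set \<Rightarrow> bool)) measure" where
  "perturbed_space \<nu> q n =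
     Pi\<^sub>M {..<n} (\<lambda>_. \<nu>) \<Otimes>\<^sub>M
     Pi\<^sub>M (nsets {..<n} 2) (\<lambda>_. measure_pmf (bernoulli_pmf q))"

definition long_edge ::
  "nat \<Rightarrow> ((nat \<Rightarrow> real) \<Rightarrow> real) \<Rightarrow> real \<Rightarrow> nat \<Rightarrow>
     (nat \<Rightarrow> nat \<Rightarrow> real) \<times> (nat set \<Rightarrow> bool) \<Rightarrow> nat \<Rightarrow> nat \<Rightarrow> bool" where
  "long_edge d N r n \<omega> u v \<longleftrightarrow>
     {u, v} \<in> perturbed_rgg d N r n \<omega> \<and> N (vdiff d (fst \<omega> u) (fst \<omega> v)) > 3 * r"

definition edge_clique_number :: "'v set \<Rightarrow> 'v set set \<Rightarrow> 'v \<Rightarrow> 'v \<Rightarrow> nat" where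
  "edge_clique_number V E u v = Max {card K | K. K \<subseteq> V \<and> clique K E \<and> u \<in> K \<and> v \<in> K}"

definition whp_long_edges_bounded ::
  "nat \<Rightarrow> ((nat \<Rightarrow> real) \<Rightarrow> real) \<Rightarrow> (nat \<Rightarrow> real) measure \<Rightarrow>
     (nat \<Rightarrow> real) \<Rightarrow> (nat \<Rightarrow> real) \<Rightarrow> (nat \<Rightarrow> real) \<Rightarrow> bool" where
  "whp_long_edges_bounded d N \<nu> r q bound \<longleftrightarrow>
     (\<lambda>n. measure (perturbed_space \<nu> (q n) n)
        {\<omega> \<in> space (perturbed_space \<nu> (q n) n).
           \<forall>u<n. \<forall>v<n. long_edge d N (r n) n \<omega> u v \<longrightarrow>
             real (edge_clique_number {..<n} (perturbed_rgg d N (r n) n \<omega>) u v) \<le> bound n})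
     \<longlonglongrightarrow> 1"

definition much_less :: "(nat \<Rightarrow> real) \<Rightarrow> (nat \<Rightarrow> real) \<Rightarrow> bool" where
  "much_less f g \<longleftrightarrow> (\<lambda>n. f n / g n) \<longlonglongrightarrow> 0"

definition standard_setting ::
  "nat \<Rightarrow> ((nat \<Rightarrow> real) \<Rightarrow> real) \<Rightarrow> (nat \<Rightarrow> real) measure \<Rightarrow>
     (nat \<Rightarrow> real) \<Rightarrow> (nat \<Rightarrow> real) \<Rightarrow> bool" where
  "standard_setting d N \<nu> r q \<longleftrightarrow>
     d \<ge> 1 \<and> is_norm d N \<and> prob_space \<nu> \<and> has_bounded_density d \<nu> \<and>
     (\<forall>n. r n > 0) \<and> r \<longlonglongrightarrow> 0 \<and> (\<forall>n. 0 \<le> q n \<and> q n \<le> 1)"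

definition intermediate_regime :: "nat \<Rightarrow> (nat \<Rightarrow> real) \<Rightarrow> bool" where
  "intermediate_regime d r \<longleftrightarrow>
     (\<forall>\<epsilon>>0. much_less (\<lambda>n. real n powr - \<epsilon>) (\<lambda>n. real n * r n ^ d)) \<and>
     much_less (\<lambda>n. real n * r n ^ d) (\<lambda>n. ln (real n))"

end

theory Submission
  imports Defs "HOL-Real_Asymp.Real_Asymp"
begin

text \<open>
  The stated bounds even hold for the clique number of the whole graph. Let \<open>A = n r^d\<close>, let
  \<open>\<rho>\<close> be \<open>A / ln n\<close> in part (a) and \<open>q\<close> in part (b), and let \<open>T = ln n / ln (1 / \<rho>)\<close>; with
  \<open>C\<^sub>1 = C\<^sub>2 = \<xi> = 1\<close>, both parts have \<open>A / ln n \<le> \<rho>\<close> and \<open>q \<le> \<rho>\<close>. Take \<open>m = \<lceil>C T\<rceil>\<close>. Since a ball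
  of radius \<open>r\<close> has probability \<open>O(r^d)\<close>, the union bound
  \<open>n * (n choose m) * (\<kappa> r^d)^m\<close> shows that with high probability every vertex has fewer than \<open>m\<close>
  neighbours in the geometric graph. Then each set of \<open>2 m\<close> vertices contains at least \<open>m^2\<close>
  geometric non-edges, so it becomes a clique with probability at most \<open>q^(m^2)\<close>, and
  \<open>n^(2 m) * q^(m^2) = (n^2 q^m)^m\<close> tends to 0. The lower bound \<open>A \<ge> n powr (- 1/2)\<close> is only needed
  for \<open>T \<ge> 1\<close>, which absorbs the rounding in \<open>m\<close>.
\<close>

section \<open>Norms and the measure of balls\<close>

lemma Rd_restrict [simp]: "restrict x {..<d} \<in> Rd d"
  by (simp add: Rd_def)

lemma is_norm_vdiff_commute:
  assumes N: "is_norm d N"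
  shows "N (vdiff d x y) = N (vdiff d y x)"
proof -
  have "vdiff d y x = vscale d (- 1) (vdiff d x y)"
    by (auto simp: vdiff_def vscale_def fun_eq_iff)
  moreover have "vdiff d x y \<in> Rd d"
    by (simp add: vdiff_def)
  ultimately show ?thesis
    using N unfolding is_norm_def by (metis abs_minus abs_one mult_1)
qed

lemma is_norm_abs_diff:
  assumes N: "is_norm d N" and x: "x \<in> Rd d" and y: "y \<in> Rd d"
  shows "\<bar>N x - N y\<bar> \<le> N (vdiff d x y)"
proof -
  have *: "N a \<le> N b + N (vdiff d a b)" if "a \<in> Rd d" "b \<in> Rd d" for a b
  proof -
    have "a = vadd d b (vdiff d a b)"
      using that by (auto simp: Rd_def vadd_def vdiff_def fun_eq_iff PiE_def extensional_def)
    moreover have "vdiff d a b \<in> Rd d"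
      by (simp add: vdiff_def)
    ultimately show ?thesis
      using N that(2) unfolding is_norm_def by metis
  qed
  show ?thesis
    using *[OF x y] *[OF y x] is_norm_vdiff_commute[OF N, of x y] by linarith
qed

text \<open>Switch on the coordinates of \<open>z\<close> one at a time: passing from
  \<open>j\<close> to \<open>Suc j\<close> adds a multiple of a unit vector, and the triangle
  inequality charges its norm. This yields a Lipschitz estimate for \<open>N\<close> in the
  coordinates.\<close>

lemma is_norm_le_coordinate_sum:
  assumes N: "is_norm d N"
  shows "N (restrict z {..<d}) \<le> (\<Sum>k<d. \<bar>z k\<bar> * N (\<lambda>i\<in>{..<d}. if i = k then 1 else 0))"
proof -
  have "j \<le> d \<Longrightarrow> N (\<lambda>i\<in>{..<d}. if i < j then z i else 0)
          \<le> (\<Sum>k<j. \<bar>z k\<bar> * N (\<lambda>i\<in>{..<d}. if i = k then 1 else 0))" for j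
  proof (induction j)
    case 0
    have "N (\<lambda>i\<in>{..<d}. 0) = 0"
      using N Rd_restrict unfolding is_norm_def by blast
    moreover have "(\<lambda>i\<in>{..<d}. if i < 0 then z i else 0) = (\<lambda>i\<in>{..<d}. 0)"
      by simp
    ultimately show ?case
      by (simp only: lessThan_0 sum.empty order_refl)
  next
    case (Suc j)
    let ?e = "\<lambda>i\<in>{..<d}. if i = j then 1 else (0::real)"
    have eq: "(\<lambda>i\<in>{..<d}. if i < Suc j then z i else 0)
        = vadd d (\<lambda>i\<in>{..<d}. if i < j then z i else 0) (vscale d (z j) ?e)"
      by (auto simp: vadd_def vscale_def fun_eq_iff less_Suc_eq)
    have "N (\<lambda>i\<in>{..<d}. if i < Suc j then z i else 0)
        \<le> N (\<lambda>i\<in>{..<d}. if i < j then z i else 0) + N (vscale d (z j) ?e)"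
      unfolding eq using N Rd_restrict unfolding is_norm_def vscale_def by blast
    moreover have "N (vscale d (z j) ?e) = \<bar>z j\<bar> * N ?e"
      using N Rd_restrict unfolding is_norm_def by blast
    ultimately show ?case
      using Suc.IH Suc.prems unfolding sum.lessThan_Suc by linarith
  qed
  from this[of d] show ?thesis
    by (simp add: restrict_def cong: if_cong)
qed

text \<open>The reverse triangle inequality and the coordinate bound dominate the increment of
  \<open>N\<close> at \<open>y\<close> by a finite sum that is continuous in the product topology
  and vanishes at \<open>y\<close>. Since \<open>Rd d\<close> is a set and not a type, continuity is
  stated on the whole space \<open>nat \<Rightarrow> real\<close>, with a restriction
  inside.\<close>

lemma is_norm_continuous:
  assumes N: "is_norm d N"
  shows "continuous_on UNIV (\<lambda>x. N (restrict x {..<d}))"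
proof -
  have "((\<lambda>x. N (restrict x {..<d})) \<longlongrightarrow> N (restrict y {..<d})) (at y)" for y
  proof -
    let ?g = "\<lambda>x. \<Sum>k<d. \<bar>x k - y k\<bar> * N (\<lambda>i\<in>{..<d}. if i = k then 1 else 0)"
    have "continuous_on UNIV ?g"
      by (intro continuous_intros continuous_on_product_then_coordinatewise continuous_on_id)
    then have "(?g \<longlongrightarrow> ?g y) (at y)"
      unfolding continuous_on_def by (rule bspec) simp
    then have "(?g \<longlongrightarrow> 0) (at y)"
      by simp
    moreover have "norm (N (restrict x {..<d}) - N (restrict y {..<d})) \<le> ?g x" for x
    proof -
      have "vdiff d (restrict x {..<d}) (restrict y {..<d}) = restrict (\<lambda>k. x k - y k) {..<d}"
        by (auto simp: vdiff_def fun_eq_iff)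
      then show ?thesis
        using is_norm_abs_diff[OF N Rd_restrict Rd_restrict, of x y]
          is_norm_le_coordinate_sum[OF N, of "\<lambda>k. x k - y k"] by simp
    qed
    then have "eventually (\<lambda>x. norm (N (restrict x {..<d}) - N (restrict y {..<d})) \<le> ?g x) (at y)"
      by (rule always_eventually[OF allI])
    ultimately have "((\<lambda>x. N (restrict x {..<d}) - N (restrict y {..<d})) \<longlongrightarrow> 0) (at y)"
      by (rule Lim_null_comparison[rotated])
    then show ?thesis
      by (rule LIM_zero_cancel)
  qed
  then show ?thesis
    by (simp add: continuous_on_def)
qed

lemma measurable_norm_vdiff:
  assumes N: "is_norm d N"
    and f [measurable]: "f \<in> measurable M (leb d)" and g [measurable]: "g \<in> measurable M (leb d)"
  shows "(\<lambda>\<omega>. N (vdiff d (f \<omega>) (g \<omega>))) \<in> borel_measurable M"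
proof -
  \<comment> \<open>Padding with zeros makes every coordinate measurable, so \<open>?h\<close> is
    Borel measurable into \<open>nat \<Rightarrow> real\<close>, where the continuity of
    \<open>N\<close> can be applied. The restriction then discards the padding.\<close>
  let ?h = "\<lambda>\<omega> k. if k < d then f \<omega> k - g \<omega> k else 0"
  have "(\<lambda>\<omega>. ?h \<omega> k) \<in> borel_measurable M" for k
  proof (cases "k < d")
    case True
    have "(\<lambda>x. x k) \<in> borel_measurable (leb d)"
      using True measurable_component_singleton[of k "{..<d}" "\<lambda>_. lborel :: real measure"]
      by (simp add: leb_def)
    then have "(\<lambda>\<omega>. f \<omega> k) \<in> borel_measurable M" "(\<lambda>\<omega>. g \<omega> k) \<in> borel_measurable M"
      using measurable_compose[OF f] measurable_compose[OF g] by blast+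
    with True show ?thesis
      by simp
  qed simp
  then have "?h \<in> borel_measurable M"
    by (intro measurable_coordinatewise_then_product)
  from borel_measurable_continuous_on[OF is_norm_continuous[OF N] this]
  have "(\<lambda>\<omega>. N (restrict (?h \<omega>) {..<d})) \<in> borel_measurable M" .
  moreover have "restrict (?h \<omega>) {..<d} = vdiff d (f \<omega>) (g \<omega>)" for \<omega>
    by (auto simp: vdiff_def fun_eq_iff)
  ultimately show ?thesis
    by simp
qed

section \<open>Comparison with boxes and the probability of balls\<close>

text \<open>One half of the equivalence of norms in finite dimension: \<open>N\<close> attains a
  positive minimum \<open>a\<close> on the compact unit sphere of the sum norm, and homogeneity
  extends the bound to all of \<open>Rd d\<close>.\<close>

lemma is_norm_ge_coordinate:
  assumes N: "is_norm d N" and d: "d \<ge> 1"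
  shows "\<exists>a>0. \<forall>x\<in>Rd d. \<forall>k<d. a * \<bar>x k\<bar> \<le> N x"
proof -
  \<comment> \<open>Coordinates from \<open>d\<close> on are pinned to 0, which makes the cube, and
    with it the sphere, compact in \<open>nat \<Rightarrow> real\<close> by Tychonoff.\<close>
  let ?Q = "PiE UNIV (\<lambda>k. if k < d then {-1..1} else {0 :: real})"
  let ?S = "?Q \<inter> {x. (\<Sum>k<d. \<bar>x k\<bar>) = 1}"
  have "compactin (product_topology (\<lambda>_. euclidean) UNIV) ?Q"
    by (subst compactin_PiE) auto
  then have "compact ?Q"
    by (simp add: euclidean_product_topology)
  moreover have "closed {x :: nat \<Rightarrow> real. (\<Sum>k<d. \<bar>x k\<bar>) = 1}"
    by (intro closed_Collect_eq continuous_intros continuous_on_product_then_coordinatewise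
        continuous_on_id)
  ultimately have "compact ?S"
    by (rule compact_Int_closed)
  \<comment> \<open>The minimum exists only on a nonempty sphere; the first unit vector lies on it
    because \<open>d \<ge> 1\<close>.\<close>
  moreover have "(\<lambda>k. if k = 0 then 1 else 0) \<in> ?S"
  proof -
    have "(\<Sum>k<d. \<bar>if k = 0 then 1 else 0 :: real\<bar>) = (\<Sum>k<d. if k = 0 then 1 else 0)"
      by (intro sum.cong) auto
    then show ?thesis
      using d by auto
  qed
  then have "?S \<noteq> {}"
    by blast
  ultimately obtain x0 where x0: "x0 \<in> ?S"
    and le: "\<And>y. y \<in> ?S \<Longrightarrow> N (restrict x0 {..<d}) \<le> N (restrict y {..<d})"
    using continuous_attains_inf[of ?S "\<lambda>x. N (restrict x {..<d})"]
      continuous_on_subset[OF is_norm_continuous[OF N]] by blast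
  let ?a = "N (restrict x0 {..<d})"
  have "restrict x0 {..<d} \<noteq> (\<lambda>k\<in>{..<d}. 0)"
  proof
    assume eq: "restrict x0 {..<d} = (\<lambda>k\<in>{..<d}. 0)"
    have "x0 k = 0" if "k < d" for k
      using fun_cong[OF eq, of k] that by simp
    then have "(\<Sum>k<d. \<bar>x0 k\<bar>) = 0"
      by simp
    with x0 show False
      by simp
  qed
  then have "?a > 0"
    using N Rd_restrict[of x0 d] unfolding is_norm_def by (metis less_eq_real_def)
  moreover have "?a * \<bar>x k\<bar> \<le> N x" if x: "x \<in> Rd d" and k: "k < d" for x k
  proof (cases "x k = 0")
    case True
    then show ?thesis
      using N x by (simp add: is_norm_def)
  next
    case False
    define s where "s = (\<Sum>k<d. \<bar>x k\<bar>)"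
    have le_s: "\<bar>x j\<bar> \<le> s" if "j < d" for j
      unfolding s_def using that by (intro member_le_sum) auto
    from le_s[OF k] False have s: "s > 0"
      by linarith
    define y where "y = (\<lambda>k. if k < d then x k / s else 0)"
    have y1: "(\<Sum>k<d. \<bar>y k\<bar>) = 1"
      using s by (simp add: y_def abs_divide flip: sum_divide_distrib) (simp add: s_def)
    have "\<bar>y j\<bar> \<le> 1" if "j < d" for j
      using le_s[OF that] s that by (simp add: y_def abs_divide)
    then have "-1 \<le> y j \<and> y j \<le> 1" if "j < d" for j
      using that by (meson abs_le_D1 abs_le_D2 minus_le_iff)
    moreover have "y j = 0" if "\<not> j < d" for j
      using that by (simp add: y_def)
    ultimately have "y \<in> ?Q"
      by (simp add: PiE_iff)
    with y1 have "?a \<le> N (restrict y {..<d})"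
      by (intro le) simp
    also have "restrict y {..<d} = vscale d (1 / s) x"
      by (auto simp: y_def vscale_def fun_eq_iff)
    also have "N \<dots> = N x / s"
      using N x s by (simp add: is_norm_def)
    finally have "?a * s \<le> N x"
      using s by (simp only: pos_le_divide_eq)
    moreover have "?a * \<bar>x k\<bar> \<le> ?a * s"
      using \<open>?a > 0\<close> le_s[OF k] by simp
    ultimately show ?thesis
      by linarith
  qed
  ultimately show ?thesis
    by blast
qed

text \<open>By the coordinate bound the ball lies in a box with all sides \<open>2 * r / a\<close>,
  whose volume is a product. Hence \<open>\<kappa> = (2 / a) ^ d\<close>, independent of centre and
  radius.\<close>

lemma closed_ball_volume:
  assumes N: "is_norm d N" and d: "d \<ge> 1"
  shows "\<exists>\<kappa>\<ge>0. \<forall>y\<in>Rd d. \<forall>r\<ge>0. emeasure (leb d) (closed_ball d N y r) \<le> ennreal (\<kappa> * r ^ d)"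
proof -
  obtain a where a: "a > 0" and le: "\<And>x k. x \<in> Rd d \<Longrightarrow> k < d \<Longrightarrow> a * \<bar>x k\<bar> \<le> N x"
    using is_norm_ge_coordinate[OF N d] by blast
  interpret P: product_sigma_finite "\<lambda>_::nat. lborel :: real measure"
    by standard
  have "emeasure (leb d) (closed_ball d N y r) \<le> ennreal ((2 / a) ^ d * r ^ d)"
    if y: "y \<in> Rd d" and r: "r \<ge> 0" for y r
  proof -
    let ?B = "PiE {..<d} (\<lambda>k. {y k - r / a .. y k + r / a})"
    have "closed_ball d N y r \<subseteq> ?B"
    proof
      fix x assume x: "x \<in> closed_ball d N y r"
      have "\<bar>x k - y k\<bar> \<le> r / a" if "k < d" for k
      proof -
        have "a * \<bar>vdiff d x y k\<bar> \<le> N (vdiff d x y)"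
          unfolding vdiff_def using that by (intro le Rd_restrict)
        with x that have "a * \<bar>x k - y k\<bar> \<le> r"
          by (simp add: closed_ball_def vdiff_def)
        with a show ?thesis
          by (simp add: field_simps)
      qed
      then have "y k - r / a \<le> x k \<and> x k \<le> y k + r / a" if "k < d" for k
        using that by (simp add: abs_diff_le_iff)
      moreover have "x \<in> Rd d"
        using x by (simp add: closed_ball_def)
      ultimately show "x \<in> ?B"
        by (simp add: Rd_def PiE_iff)
    qed
    then have "emeasure (leb d) (closed_ball d N y r) \<le> emeasure (leb d) ?B"
      by (intro emeasure_mono) (auto simp: leb_def intro!: sets_PiM_I_finite)
    also have "\<dots> = (\<Prod>k<d. emeasure lborel {y k - r / a .. y k + r / a})"
      unfolding leb_def by (intro P.emeasure_PiM) auto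
    also have "\<dots> = (\<Prod>k<d. ennreal (2 / a * r))"
      using a r by (intro prod.cong refl) (simp add: field_simps)
    also have "\<dots> = ennreal ((2 / a) ^ d * r ^ d)"
      using a r by (simp add: ennreal_power power_mult_distrib power_divide)
    finally show ?thesis .
  qed
  with a show ?thesis
    by (intro exI[of _ "(2 / a) ^ d"]) auto
qed

lemma closed_ball_measurable:
  assumes N: "is_norm d N" and y: "y \<in> Rd d"
  shows "closed_ball d N y r \<in> sets (leb d)"
proof -
  have sp: "space (leb d) = Rd d"
    by (simp add: leb_def space_PiM Rd_def)
  have [measurable]: "(\<lambda>x. N (vdiff d x y)) \<in> borel_measurable (leb d)"
    using y sp by (intro measurable_norm_vdiff[OF N]) auto
  have "{x \<in> space (leb d). N (vdiff d x y) \<le> r} \<in> sets (leb d)"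
    by measurable
  then show ?thesis
    by (simp add: closed_ball_def sp)
qed

text \<open>If \<open>c\<close> bounds the density, probabilities are at most \<open>c\<close> times
  volumes. The bound is uniform in the centre, which allows centring the ball at a random point
  later.\<close>

lemma bounded_density_ball:
  assumes N: "is_norm d N" and d: "d \<ge> 1" and \<nu>: "has_bounded_density d \<nu>"
  shows "\<exists>\<kappa>\<ge>0. \<forall>y\<in>Rd d. \<forall>r\<ge>0. emeasure \<nu> (closed_ball d N y r) \<le> ennreal (\<kappa> * r ^ d)"
proof -
  obtain f c where f: "f \<in> borel_measurable (leb d)" and fc: "\<forall>x\<in>Rd d. 0 \<le> f x \<and> f x \<le> c"
    and eq: "\<nu> = density (leb d) (\<lambda>x. ennreal (f x))"
    using \<nu> unfolding has_bounded_density_def by blast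
  have c: "c \<ge> 0"
    using bspec[OF fc Rd_restrict[of undefined d]] by linarith
  obtain \<kappa> where \<kappa>: "\<kappa> \<ge> 0" and vol: "\<And>y r. y \<in> Rd d \<Longrightarrow> r \<ge> 0 \<Longrightarrow>
      emeasure (leb d) (closed_ball d N y r) \<le> ennreal (\<kappa> * r ^ d)"
    using closed_ball_volume[OF N d] by blast
  have "emeasure \<nu> (closed_ball d N y r) \<le> ennreal (c * \<kappa> * r ^ d)"
    if y: "y \<in> Rd d" and r: "r \<ge> 0" for y r
  proof -
    let ?B = "closed_ball d N y r"
    have B: "?B \<in> sets (leb d)"
      using N y by (rule closed_ball_measurable)
    have "emeasure \<nu> ?B = (\<integral>\<^sup>+x. ennreal (f x) * indicator ?B x \<partial>leb d)"
      unfolding eq using f B by (intro emeasure_density) auto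
    also have "\<dots> \<le> (\<integral>\<^sup>+x. ennreal c * indicator ?B x \<partial>leb d)"
      using fc by (intro nn_integral_mono mult_right_mono)
        (auto simp: leb_def space_PiM Rd_def intro!: ennreal_leI)
    also have "\<dots> = ennreal c * emeasure (leb d) ?B"
      using B by (simp add: nn_integral_cmult_indicator)
    also have "\<dots> \<le> ennreal c * ennreal (\<kappa> * r ^ d)"
      using vol[OF y r] by (intro mult_left_mono) auto
    also have "\<dots> = ennreal (c * \<kappa> * r ^ d)"
      using c \<kappa> r by (simp add: mult.assoc flip: ennreal_mult)
    finally show ?thesis .
  qed
  with c \<kappa> show ?thesis
    by (intro exI[of _ "c * \<kappa>"]) auto
qed

section \<open>Degrees and cliques\<close>

lemma edge_rgg_iff:
  assumes N: "is_norm d N"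
  shows "{i, j} \<in> rgg d N r n x \<longleftrightarrow> i < n \<and> j < n \<and> i \<noteq> j \<and> N (vdiff d (x j) (x i)) \<le> r"
  using is_norm_vdiff_commute[OF N, of "x i" "x j"] by (auto simp: rgg_def doubleton_eq_iff)

lemma rgg_subset: "rgg d N r n x \<subseteq> nsets {..<n} 2"
  by (auto simp: rgg_def nsets_def)

lemma perturbed_rgg_subset: "perturbed_rgg d N r n \<omega> \<subseteq> nsets {..<n} 2"
  using rgg_subset[of d N r n "fst \<omega>"] by (auto simp: perturbed_rgg_def split: prod.split)

lemma finite_nsets_lessThan [simp]: "finite (nsets {..<n::nat} k)"
  by (simp add: finite_imp_finite_nsets)

lemma clique_eq_nsets: "clique K E \<longleftrightarrow> nsets K 2 \<subseteq> E"
proof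
  assume "clique K E"
  then show "nsets K 2 \<subseteq> E"
    unfolding clique_def nsets_def card_2_iff by blast
next
  assume E: "nsets K 2 \<subseteq> E"
  have "{v, w} \<in> nsets K 2" if "v \<in> K" "w \<in> K" "v \<noteq> w" for v w
    using that by (simp add: nsets_def)
  with E show "clique K E"
    unfolding clique_def by blast
qed

text \<open>Double counting of ordered nonadjacent pairs. Each vertex has at least
  \<open>(2 * m - 1) - (m - 1) = m\<close> non-neighbours in \<open>K\<close>, so there are at least
  \<open>2 * m * m\<close> ordered pairs, and each unordered pair accounts for at most two of
  them.\<close>

lemma card_nonadjacent_pairs:
  assumes K: "finite K" "card K = 2 * m" and deg: "\<And>i. i \<in> K \<Longrightarrow> card {j \<in> K. {i, j} \<in> E} < m"
  shows "m * m \<le> card (nsets K 2 - E)"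
proof -
  let ?F = "nsets K 2 - E"
  let ?P = "Sigma K (\<lambda>i. {j \<in> K. j \<noteq> i \<and> {i, j} \<notin> E})"
  let ?O = "\<lambda>e. {(i, j). i \<noteq> j \<and> e = {i, j}}"
  have F: "finite ?F"
    using K by (simp add: finite_imp_finite_nsets)
  have "m \<le> card {j \<in> K. j \<noteq> i \<and> {i, j} \<notin> E}" if i: "i \<in> K" for i
  proof -
    have "{j \<in> K. j \<noteq> i \<and> {i, j} \<notin> E} = (K - {i}) - {j \<in> K. {i, j} \<in> E}"
      by auto
    then have "card {j \<in> K. j \<noteq> i \<and> {i, j} \<notin> E} \<ge> card (K - {i}) - card {j \<in> K. {i, j} \<in> E}"
      using K diff_card_le_card_Diff[of "{j \<in> K. {i, j} \<in> E}" "K - {i}"] by simp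
    with deg[OF i] K i show ?thesis
      by simp
  qed
  then have "(\<Sum>i\<in>K. m) \<le> (\<Sum>i\<in>K. card {j \<in> K. j \<noteq> i \<and> {i, j} \<notin> E})"
    by (rule sum_mono)
  also have "\<dots> = card ?P"
    using K by (subst card_SigmaI) auto
  finally have "2 * m * m \<le> card ?P"
    using K by simp
  also have "card ?P \<le> card (\<Union>e\<in>?F. ?O e)"
  proof (rule card_mono)
    have "?O e \<subseteq> e \<times> e" for e :: "'a set"
      by auto
    then have "finite (?O e)" if "e \<in> ?F" for e
      using that finite_subset[of "?O e" "e \<times> e"] by (auto simp: nsets_def)
    then show "finite (\<Union>e\<in>?F. ?O e)"
      using F by blast
    show "?P \<subseteq> (\<Union>e\<in>?F. ?O e)"
    proof
      fix z assume "z \<in> ?P"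
      then obtain i j where z: "z = (i, j)" "i \<in> K" "j \<in> K" "j \<noteq> i" "{i, j} \<notin> E"
        by blast
      then have "{i, j} \<in> ?F"
        by (simp add: nsets_def)
      with z show "z \<in> (\<Union>e\<in>?F. ?O e)"
        by blast
    qed
  qed
  also have "\<dots> \<le> (\<Sum>e\<in>?F. card (?O e))"
    using F by (rule card_UN_le)
  also have "\<dots> \<le> (\<Sum>e\<in>?F. 2)"
  proof (rule sum_mono)
    fix e assume "e \<in> ?F"
    then obtain a b where e: "e = {a, b}"
      by (auto simp: nsets_def card_2_iff)
    have "?O e \<subseteq> {(a, b), (b, a)}"
      unfolding e by (auto simp: doubleton_eq_iff)
    then have "card (?O e) \<le> card {(a, b), (b, a)}"
      by (rule card_mono[rotated]) simp
    also have "\<dots> \<le> 2"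
      using card_length[of "[(a, b), (b, a)]"] by simp
    finally show "card (?O e) \<le> 2" .
  qed
  finally show ?thesis
    by simp
qed

text \<open>The event is a box in the product space, so its probability factorizes: \<open>q\<close>
  for each coin in \<open>F\<close> and 1 for every other coin.\<close>

lemma coins_all_heads:
  assumes q: "0 \<le> q" "q \<le> 1" and I: "finite I" and F: "F \<subseteq> I"
  defines "M \<equiv> Pi\<^sub>M I (\<lambda>_. measure_pmf (bernoulli_pmf q))"
  shows "{b \<in> space M. \<forall>e\<in>F. b e} \<in> sets M"
    and "emeasure M {b \<in> space M. \<forall>e\<in>F. b e} = ennreal (q ^ card F)"
proof -
  interpret P: product_prob_space "\<lambda>_. measure_pmf (bernoulli_pmf q)"
    by standard
  have eq: "{b \<in> space M. \<forall>e\<in>F. b e} = PiE I (\<lambda>e. if e \<in> F then {True} else UNIV)"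
    using F by (auto simp: M_def space_PiM PiE_iff extensional_def split: if_splits)
  show "{b \<in> space M. \<forall>e\<in>F. b e} \<in> sets M"
    unfolding eq unfolding M_def by (intro sets_PiM_I_finite I) auto
  have "emeasure M {b \<in> space M. \<forall>e\<in>F. b e}
      = (\<Prod>e\<in>I. emeasure (measure_pmf (bernoulli_pmf q)) (if e \<in> F then {True} else UNIV))"
    unfolding eq unfolding M_def by (intro P.emeasure_PiM I) auto
  also have "\<dots> = (\<Prod>e\<in>I. if e \<in> F then ennreal q else 1)"
    using q P.emeasure_space_1 by (intro prod.cong) (auto simp: emeasure_pmf_single)
  also have "\<dots> = ennreal q ^ card F"
    using I F by (simp add: prod.If_cases Int_absorb1)
  finally show "emeasure M {b \<in> space M. \<forall>e\<in>F. b e} = ennreal (q ^ card F)"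
    using q by (simp add: ennreal_power)
qed

text \<open>The points \<open>x\<close> are fixed here and only the coins are random. A set
  \<open>K\<close> of \<open>2 * m\<close> vertices becomes a clique only if the coins of all its
  geometric non-edges show heads. The degree bound provides at least \<open>m * m\<close> of these,
  and a union bound over \<open>K\<close> finishes.\<close>

lemma coins_clique_bound:
  assumes q: "0 \<le> q" "q \<le> 1"
    and deg: "\<And>i. i < n \<Longrightarrow> card {j. {i, j} \<in> rgg d N r n x} < m"
  defines "M \<equiv> Pi\<^sub>M (nsets {..<n} 2) (\<lambda>_. measure_pmf (bernoulli_pmf q))"
  shows "emeasure M {b \<in> space M. \<exists>K\<in>nsets {..<n} (2 * m). clique K (perturbed_rgg d N r n (x, b))}
     \<le> ennreal (real n ^ (2 * m) * q ^ (m * m))"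
proof -
  let ?A = "\<lambda>K. {b \<in> space M. \<forall>e\<in>nsets K 2 - rgg d N r n x. b e}"
  have sub: "nsets K 2 - rgg d N r n x \<subseteq> nsets {..<n} 2" if "K \<in> nsets {..<n} (2 * m)" for K
    using that by (auto simp: nsets_def)
  have sets: "?A K \<in> sets M" if "K \<in> nsets {..<n} (2 * m)" for K
    using coins_all_heads(1)[OF q _ sub[OF that]] unfolding M_def by simp
  have bound: "emeasure M (?A K) \<le> ennreal (q ^ (m * m))" if K: "K \<in> nsets {..<n} (2 * m)" for K
  proof -
    have fin: "finite {j. {i, j} \<in> rgg d N r n x}" for i
      by (rule finite_subset[of _ "{..<n}"]) (auto simp: rgg_def doubleton_eq_iff)
    have "card {j \<in> K. {i, j} \<in> rgg d N r n x} < m" if "i \<in> K" for i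
    proof -
      have "card {j \<in> K. {i, j} \<in> rgg d N r n x} \<le> card {j. {i, j} \<in> rgg d N r n x}"
        by (intro card_mono fin) auto
      also have "\<dots> < m"
        using K that by (intro deg) (auto simp: nsets_def)
      finally show ?thesis .
    qed
    then have "m * m \<le> card (nsets K 2 - rgg d N r n x)"
      using K by (intro card_nonadjacent_pairs) (auto simp: nsets_def)
    with q have "q ^ card (nsets K 2 - rgg d N r n x) \<le> q ^ (m * m)"
      by (intro power_decreasing)
    then show ?thesis
      using coins_all_heads(2)[OF q _ sub[OF K]] unfolding M_def by (simp add: ennreal_leI)
  qed
  have "{b \<in> space M. \<exists>K\<in>nsets {..<n} (2 * m). clique K (perturbed_rgg d N r n (x, b))}
      \<subseteq> (\<Union>K\<in>nsets {..<n} (2 * m). ?A K)"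
    by (fastforce simp: clique_eq_nsets perturbed_rgg_def)
  then have "emeasure M {b \<in> space M. \<exists>K\<in>nsets {..<n} (2 * m). clique K (perturbed_rgg d N r n (x, b))}
      \<le> emeasure M (\<Union>K\<in>nsets {..<n} (2 * m). ?A K)"
    by (rule emeasure_mono) (intro sets.finite_UN sets finite_nsets_lessThan)
  also have "\<dots> \<le> (\<Sum>K\<in>nsets {..<n} (2 * m). emeasure M (?A K))"
    using sets by (intro emeasure_subadditive_finite) auto
  also have "\<dots> \<le> (\<Sum>K\<in>nsets {..<n} (2 * m). ennreal (q ^ (m * m)))"
    by (intro sum_mono bound)
  also have "\<dots> = ennreal (real (n choose (2 * m)) * q ^ (m * m))"
    using q by (simp add: ennreal_of_nat_eq_real_of_nat flip: ennreal_mult)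
  also have "\<dots> \<le> ennreal (real n ^ (2 * m) * q ^ (m * m))"
  proof (intro ennreal_leI mult_right_mono)
    have "n choose (2 * m) \<le> n ^ (2 * m)"
      by (cases "2 * m \<le> n") (auto simp: binomial_le_pow binomial_eq_0)
    then show "real (n choose (2 * m)) \<le> real n ^ (2 * m)"
      by (simp flip: of_nat_power)
  qed (use q in simp)
  finally show ?thesis .
qed

section \<open>Measurability of events about the random graphs\<close>

text \<open>A random subset of a finite set has finitely many values, and each level set is a finite
  intersection of membership events and their complements. Thus any property \<open>Q\<close> of the
  graph, including one about its clique numbers, is measurable once single edges are.\<close>

lemma sets_Collect_finite_valued:
  assumes A: "finite A" and f: "\<And>\<omega>. \<omega> \<in> space M \<Longrightarrow> f \<omega> \<subseteq> A"
    and e: "\<And>e. e \<in> A \<Longrightarrow> {\<omega> \<in> space M. e \<in> f \<omega>} \<in> sets M"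
  shows "{\<omega> \<in> space M. Q (f \<omega>)} \<in> sets M"
proof -
  have "{\<omega> \<in> space M. \<forall>e\<in>A. e \<in> f \<omega> \<longleftrightarrow> e \<in> E} \<in> sets M" for E
  proof (intro sets.sets_Collect_finite_All A)
    fix e assume "e \<in> A"
    from e[OF this] show "{\<omega> \<in> space M. e \<in> f \<omega> \<longleftrightarrow> e \<in> E} \<in> sets M"
      by (cases "e \<in> E") (auto intro: sets.sets_Collect_neg)
  qed
  then have "(\<Union>E\<in>{E \<in> Pow A. Q E}. {\<omega> \<in> space M. \<forall>e\<in>A. e \<in> f \<omega> \<longleftrightarrow> e \<in> E}) \<in> sets M"
    using A by (intro sets.finite_UN) auto
  also have "(\<Union>E\<in>{E \<in> Pow A. Q E}. {\<omega> \<in> space M. \<forall>e\<in>A. e \<in> f \<omega> \<longleftrightarrow> e \<in> E})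
      = {\<omega> \<in> space M. Q (f \<omega>)}"
  proof (intro equalityI subsetI)
    fix \<omega> assume "\<omega> \<in> (\<Union>E\<in>{E \<in> Pow A. Q E}. {\<omega> \<in> space M. \<forall>e\<in>A. e \<in> f \<omega> \<longleftrightarrow> e \<in> E})"
    then obtain E where E: "\<omega> \<in> space M" "E \<subseteq> A" "Q E" "\<forall>e\<in>A. e \<in> f \<omega> \<longleftrightarrow> e \<in> E"
      by blast
    then have "f \<omega> = E"
      using f[of \<omega>] by blast
    with E show "\<omega> \<in> {\<omega> \<in> space M. Q (f \<omega>)}"
      by simp
  qed (use f in blast)
  finally show ?thesis .
qed

lemma measurable_edge_length:
  fixes n :: nat
  assumes N: "is_norm d N" and \<nu>: "sets \<nu> = sets (leb d)" and ij: "i < n" "j < n"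
    and f: "f \<in> measurable M (Pi\<^sub>M {..<n} (\<lambda>_. \<nu>))"
  shows "(\<lambda>\<omega>. N (vdiff d (f \<omega> i) (f \<omega> j))) \<in> borel_measurable M"
proof (rule measurable_norm_vdiff[OF N])
  have "(\<lambda>\<omega>. f \<omega> k) \<in> measurable M (leb d)" if "k < n" for k
  proof -
    have "(\<lambda>\<omega>. f \<omega> k) \<in> measurable M \<nu>"
      using that by (intro measurable_compose[OF f] measurable_component_singleton) simp
    then show ?thesis
      using \<nu> by (simp cong: measurable_cong_sets)
  qed
  with ij show "(\<lambda>\<omega>. f \<omega> i) \<in> measurable M (leb d)" "(\<lambda>\<omega>. f \<omega> j) \<in> measurable M (leb d)"
    by blast+
qed

lemma sets_Collect_rgg:
  assumes N: "is_norm d N" and \<nu>: "sets \<nu> = sets (leb d)"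
    and f: "f \<in> measurable M (Pi\<^sub>M {..<n} (\<lambda>_. \<nu>))"
  shows "{\<omega> \<in> space M. Q (rgg d N r n (f \<omega>))} \<in> sets M"
proof (rule sets_Collect_finite_valued[where A = "nsets {..<n} 2"])
  fix e assume "e \<in> nsets {..<n} 2"
  then obtain i j where e: "e = {i, j}" and ij: "i < n" "j < n" "i \<noteq> j"
    by (auto simp: nsets_def card_2_iff)
  have [measurable]: "(\<lambda>\<omega>. N (vdiff d (f \<omega> j) (f \<omega> i))) \<in> borel_measurable M"
    by (rule measurable_edge_length[OF N \<nu> ij(2,1) f])
  have "{\<omega> \<in> space M. N (vdiff d (f \<omega> j) (f \<omega> i)) \<le> r} \<in> sets M"
    by measurable
  then show "{\<omega> \<in> space M. e \<in> rgg d N r n (f \<omega>)} \<in> sets M"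
    unfolding e edge_rgg_iff[OF N] using ij by simp
qed (use rgg_subset in auto)

lemma sets_Collect_perturbed_rgg:
  assumes N: "is_norm d N" and \<nu>: "sets \<nu> = sets (leb d)"
  shows "{\<omega> \<in> space (perturbed_space \<nu> q n). Q (perturbed_rgg d N r n \<omega>)}
    \<in> sets (perturbed_space \<nu> q n)"
proof (rule sets_Collect_finite_valued[where A = "nsets {..<n} 2"])
  let ?S = "perturbed_space \<nu> q n"
  fix e assume e: "e \<in> nsets {..<n} 2"
  have "fst \<in> measurable ?S (Pi\<^sub>M {..<n} (\<lambda>_. \<nu>))"
    by (simp add: perturbed_space_def)
  then have "{\<omega> \<in> space ?S. e \<in> rgg d N r n (fst \<omega>)} \<in> sets ?S"
    by (rule sets_Collect_rgg[OF N \<nu>])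
  moreover have "{\<omega> \<in> space ?S. snd \<omega> e} \<in> sets ?S"
  proof -
    have "(\<lambda>\<omega>. snd \<omega> e) \<in> measurable ?S (measure_pmf (bernoulli_pmf q))"
      unfolding perturbed_space_def
      by (intro measurable_compose[OF measurable_snd] measurable_component_singleton e)
    from measurable_sets[OF this, of "{True}"] show ?thesis
      by (simp add: vimage_def Int_def conj_commute)
  qed
  ultimately have "{\<omega> \<in> space ?S. e \<in> rgg d N r n (fst \<omega>) \<or> snd \<omega> e} \<in> sets ?S"
    by (simp add: sets.sets_Collect_disj)
  also have "{\<omega> \<in> space ?S. e \<in> rgg d N r n (fst \<omega>) \<or> snd \<omega> e}
      = {\<omega> \<in> space ?S. e \<in> perturbed_rgg d N r n \<omega>}"
    using e by (auto simp: perturbed_rgg_def split: prod.splits)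
  finally show "{\<omega> \<in> space ?S. e \<in> perturbed_rgg d N r n \<omega>} \<in> sets ?S" .
qed (use perturbed_rgg_subset in auto)

section \<open>Large degrees and the failure probability\<close>

text \<open>Condition on the centre: given \<open>x i = y\<close>, the remaining points are
  independent, and each point indexed by \<open>S\<close> falls into the ball around
  \<open>y\<close> with probability at most \<open>p\<close>, whatever \<open>y\<close> is.\<close>

lemma emeasure_points_in_ball:
  fixes n :: nat
  assumes N: "is_norm d N" and \<nu>: "sets \<nu> = sets (leb d)" and "prob_space \<nu>"
    and p: "\<And>y. y \<in> Rd d \<Longrightarrow> emeasure \<nu> (closed_ball d N y r) \<le> ennreal p"
    and i: "i < n" and S: "S \<subseteq> {..<n} - {i}" and p0: "0 \<le> p"
  defines "M \<equiv> Pi\<^sub>M {..<n} (\<lambda>_. \<nu>)"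
  shows "emeasure M {x \<in> space M. \<forall>j\<in>S. N (vdiff d (x j) (x i)) \<le> r} \<le> ennreal (p ^ card S)"
    and "{x \<in> space M. \<forall>j\<in>S. N (vdiff d (x j) (x i)) \<le> r} \<in> sets M"
proof -
  interpret prob_space \<nu> by fact
  interpret P: product_prob_space "\<lambda>_::nat. \<nu>"
    by standard
  have sp: "space \<nu> = Rd d"
    using sets_eq_imp_space_eq[OF \<nu>] by (simp add: leb_def space_PiM Rd_def)
  let ?I = "{..<n} - {i}"
  let ?A = "{x \<in> space M. \<forall>j\<in>S. N (vdiff d (x j) (x i)) \<le> r}"
  have ins: "{..<n} = insert i ?I"
    using i by auto
  show A: "?A \<in> sets M"
  proof (intro sets.sets_Collect_finite_All)
    fix j assume "j \<in> S"
    then have [measurable]: "(\<lambda>x. N (vdiff d (x j) (x i))) \<in> borel_measurable M"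
      using S i unfolding M_def by (intro measurable_edge_length[OF N \<nu>, of _ n]) auto
    show "{x \<in> space M. N (vdiff d (x j) (x i)) \<le> r} \<in> sets M"
      by measurable
  qed (rule finite_subset[OF S], simp)
  have "emeasure M ?A = (\<integral>\<^sup>+x. indicator ?A x \<partial>M)"
    using A by simp
  \<comment> \<open>Fubini splits off coordinate \<open>i\<close> and integrates over it last; for
    fixed \<open>y\<close> the inner event is the box \<open>?B\<close>.\<close>
  also have "\<dots> = (\<integral>\<^sup>+y. (\<integral>\<^sup>+x. indicator ?A (x(i := y)) \<partial>Pi\<^sub>M ?I (\<lambda>_. \<nu>)) \<partial>\<nu>)"
    using P.product_nn_integral_insert_rev[of ?I i "indicator ?A"] A
    unfolding ins[symmetric] M_def by simp
  also have "\<dots> \<le> (\<integral>\<^sup>+y. ennreal (p ^ card S) \<partial>\<nu>)"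
  proof (rule nn_integral_mono)
    fix y assume y: "y \<in> space \<nu>"
    let ?B = "PiE ?I (\<lambda>j. if j \<in> S then closed_ball d N y r else space \<nu>)"
    have ball: "closed_ball d N y r \<in> sets \<nu>"
      using y sp unfolding \<nu> by (intro closed_ball_measurable[OF N]) simp
    then have B: "?B \<in> sets (Pi\<^sub>M ?I (\<lambda>_. \<nu>))"
      by (intro sets_PiM_I_finite) auto
    have "(\<integral>\<^sup>+x. indicator ?A (x(i := y)) \<partial>Pi\<^sub>M ?I (\<lambda>_. \<nu>))
        = (\<integral>\<^sup>+x. indicator ?B x \<partial>Pi\<^sub>M ?I (\<lambda>_. \<nu>))"
    proof (rule nn_integral_cong)
      fix x assume x: "x \<in> space (Pi\<^sub>M ?I (\<lambda>_. \<nu>))"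
      have "x(i := y) \<in> space M"
        using x y i unfolding M_def by (auto simp: space_PiM PiE_iff extensional_def)
      moreover have "(x(i := y)) j = x j" if "j \<in> S" for j
        using that S by auto
      moreover have "x \<in> ?B \<longleftrightarrow> (\<forall>j\<in>S. N (vdiff d (x j) y) \<le> r)"
        using x S sp by (auto simp: space_PiM PiE_iff closed_ball_def)
      ultimately show "indicator ?A (x(i := y)) = (indicator ?B x :: ennreal)"
        by (auto simp: indicator_def)
    qed
    also have "\<dots> = emeasure (Pi\<^sub>M ?I (\<lambda>_. \<nu>)) ?B"
      using B by simp
    also have "\<dots> = (\<Prod>j\<in>?I. emeasure \<nu> (if j \<in> S then closed_ball d N y r else space \<nu>))"
      using ball by (intro P.emeasure_PiM) auto
    also have "\<dots> \<le> (\<Prod>j\<in>?I. if j \<in> S then ennreal p else 1)"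
      using p y sp emeasure_space_1 by (intro prod_mono_ennreal) auto
    also have "\<dots> = ennreal (p ^ card S)"
      using S p0 by (simp add: prod.If_cases Int_absorb1 ennreal_power)
    finally show "(\<integral>\<^sup>+x. indicator ?A (x(i := y)) \<partial>Pi\<^sub>M ?I (\<lambda>_. \<nu>)) \<le> ennreal (p ^ card S)" .
  qed
  also have "\<dots> = ennreal (p ^ card S)"
    by (simp add: emeasure_space_1)
  finally show "emeasure M ?A \<le> ennreal (p ^ card S)" .
qed

text \<open>A vertex \<open>i\<close> of degree at least \<open>m\<close> has \<open>m\<close>
  neighbours forming a set \<open>S\<close> that avoids \<open>i\<close>. The union bound runs over
  all pairs \<open>(i, S)\<close>; the number of choices of \<open>S\<close> is rounded up from
  \<open>(n - 1) choose m\<close> to \<open>n choose m\<close>.\<close>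

lemma large_degree_bound:
  fixes n :: nat
  assumes N: "is_norm d N" and \<nu>: "sets \<nu> = sets (leb d)" and "prob_space \<nu>"
    and p: "\<And>y. y \<in> Rd d \<Longrightarrow> emeasure \<nu> (closed_ball d N y r) \<le> ennreal p" and p0: "0 \<le> p"
  defines "M \<equiv> Pi\<^sub>M {..<n} (\<lambda>_. \<nu>)"
  shows "emeasure M {x \<in> space M. \<exists>i<n. m \<le> card {j. {i, j} \<in> rgg d N r n x}}
    \<le> ennreal (real n * (real (n choose m) * p ^ m))"
proof -
  let ?A = "\<lambda>i S. {x \<in> space M. \<forall>j\<in>S. N (vdiff d (x j) (x i)) \<le> r}"
  let ?J = "Sigma {..<n} (\<lambda>i. nsets ({..<n} - {i}) m)"
  have J: "finite ?J"
    by (auto simp: finite_imp_finite_nsets)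
  have S: "?A i S \<in> sets M" "emeasure M (?A i S) \<le> ennreal (p ^ m)" if "(i, S) \<in> ?J" for i S
  proof -
    have i: "i < n" and S: "S \<subseteq> {..<n} - {i}" and m: "card S = m"
      using that by (auto simp: nsets_def)
    show "?A i S \<in> sets M"
      unfolding M_def by (rule emeasure_points_in_ball(2)[OF N \<nu> \<open>prob_space \<nu>\<close> p i S p0])
    show "emeasure M (?A i S) \<le> ennreal (p ^ m)"
      unfolding M_def m[symmetric]
      by (rule emeasure_points_in_ball(1)[OF N \<nu> \<open>prob_space \<nu>\<close> p i S p0])
  qed
  have "{x \<in> space M. \<exists>i<n. m \<le> card {j. {i, j} \<in> rgg d N r n x}} \<subseteq> (\<Union>(i, S)\<in>?J. ?A i S)"
  proof
    fix x assume "x \<in> {x \<in> space M. \<exists>i<n. m \<le> card {j. {i, j} \<in> rgg d N r n x}}"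
    then obtain i where x: "x \<in> space M" and i: "i < n" "m \<le> card {j. {i, j} \<in> rgg d N r n x}"
      by blast
    obtain S where S: "S \<subseteq> {j. {i, j} \<in> rgg d N r n x}" "card S = m" "finite S"
      using obtain_subset_with_card_n[OF i(2)] by metis
    have "S \<in> nsets ({..<n} - {i}) m"
      using S by (auto simp: nsets_def edge_rgg_iff[OF N])
    moreover have "x \<in> ?A i S"
      using S x by (auto simp: edge_rgg_iff[OF N])
    ultimately show "x \<in> (\<Union>(i, S)\<in>?J. ?A i S)"
      using i by blast
  qed
  then have "emeasure M {x \<in> space M. \<exists>i<n. m \<le> card {j. {i, j} \<in> rgg d N r n x}}
      \<le> emeasure M (\<Union>(i, S)\<in>?J. ?A i S)"
    by (rule emeasure_mono) (rule sets.finite_UN[OF J], clarify, rule S(1), simp)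
  also have "\<dots> \<le> (\<Sum>(i, S)\<in>?J. emeasure M (?A i S))"
    unfolding case_prod_beta by (rule emeasure_subadditive_finite[OF J], clarify, rule S(1)) simp
  also have "\<dots> \<le> (\<Sum>(i, S)\<in>?J. ennreal (p ^ m))"
    using S(2) by (intro sum_mono) auto
  also have "\<dots> = (\<Sum>i<n. \<Sum>S\<in>nsets ({..<n} - {i}) m. ennreal (p ^ m))"
    by (subst sum.Sigma) (auto simp: finite_imp_finite_nsets)
  also have "\<dots> \<le> (\<Sum>i<n. ennreal (real (n choose m) * p ^ m))"
  proof (rule sum_mono)
    fix i assume "i \<in> {..<n}"
    have "(n - 1) choose m \<le> n choose m"
      by (rule binomial_right_mono) simp
    with \<open>i \<in> {..<n}\<close> show "(\<Sum>S\<in>nsets ({..<n} - {i}) m. ennreal (p ^ m)) \<le> ennreal (real (n choose m) * p ^ m)"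
      using p0 by (auto simp: ennreal_of_nat_eq_real_of_nat simp flip: ennreal_mult intro!: ennreal_leI mult_right_mono)
  qed
  also have "\<dots> = ennreal (real n * (real (n choose m) * p ^ m))"
    using p0 by (simp add: ennreal_of_nat_eq_real_of_nat flip: ennreal_mult)
  finally show ?thesis .
qed

\<comment> \<open>The error \<open>?\<epsilon>\<close> is read off from the proof as a sum of two
  terms: the union bound for some degree reaching \<open>m\<close>, and the bound for a clique of
  size \<open>2 * m\<close> when all degrees stay below \<open>m\<close>.\<close>
schematic_goal measure_long_edges_bounded:
  fixes n m :: nat
  assumes N: "is_norm d N" and \<nu>: "sets \<nu> = sets (leb d)" and "prob_space \<nu>"
    and p: "\<And>y. y \<in> Rd d \<Longrightarrow> emeasure \<nu> (closed_ball d N y r) \<le> ennreal p" and p0: "0 \<le> p"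
    and q: "0 \<le> q" "q \<le> 1" and B: "real (2 * m) \<le> B"
  defines "S \<equiv> perturbed_space \<nu> q n"
  shows "\<bar>measure S {\<omega> \<in> space S. \<forall>u<n. \<forall>v<n. long_edge d N r n \<omega> u v \<longrightarrow>
             real (edge_clique_number {..<n} (perturbed_rgg d N r n \<omega>) u v) \<le> B} - 1\<bar> \<le> ?\<epsilon>"
proof -
  let ?X = "Pi\<^sub>M {..<n} (\<lambda>_. \<nu>)"
  let ?Y = "Pi\<^sub>M (nsets {..<n} 2) (\<lambda>_. measure_pmf (bernoulli_pmf q))"
  interpret X: prob_space ?X
    by (intro prob_space_PiM \<open>prob_space \<nu>\<close>)
  interpret Y: prob_space ?Y
    by (intro prob_space_PiM measure_pmf.prob_space_axioms)
  have S: "S = ?X \<Otimes>\<^sub>M ?Y"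
    by (simp add: S_def perturbed_space_def)
  interpret XY: pair_prob_space ?X ?Y ..
  interpret S: prob_space S
    unfolding S by (rule XY.prob_space_axioms)
  let ?E = "perturbed_rgg d N r n"
  let ?good = "{\<omega> \<in> space S. \<forall>u<n. \<forall>v<n. long_edge d N r n \<omega> u v \<longrightarrow>
             real (edge_clique_number {..<n} (?E \<omega>) u v) \<le> B}"
  let ?bad = "{\<omega> \<in> space S. \<exists>K\<in>nsets {..<n} (2 * m). clique K (?E \<omega>)}"
  let ?dense = "{x \<in> space ?X. \<exists>i<n. m \<le> card {j. {i, j} \<in> rgg d N r n x}}"
  have bad: "?bad \<in> sets S"
    unfolding S_def by (rule sets_Collect_perturbed_rgg[OF N \<nu>])
  have dense: "?dense \<in> sets ?X"
    by (rule sets_Collect_rgg[OF N \<nu>]) simp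
  have good: "?good \<in> sets S"
  proof -
    have "{\<omega> \<in> space S. long_edge d N r n \<omega> u v \<longrightarrow>
        real (edge_clique_number {..<n} (?E \<omega>) u v) \<le> B} \<in> sets S" if "u < n" "v < n" for u v
    proof -
      have "fst \<in> measurable S ?X"
        by (simp add: S)
      then have [measurable]: "(\<lambda>\<omega>. N (vdiff d (fst \<omega> u) (fst \<omega> v))) \<in> borel_measurable S"
        using that by (intro measurable_edge_length[OF N \<nu>])
      have [measurable]: "Measurable.pred S (\<lambda>\<omega>. {u, v} \<in> ?E \<omega>)"
        "Measurable.pred S (\<lambda>\<omega>. real (edge_clique_number {..<n} (?E \<omega>) u v) \<le> B)"
        unfolding pred_def S_def by (rule sets_Collect_perturbed_rgg[OF N \<nu>])+
      show ?thesis
        unfolding long_edge_def by measurable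
    qed
    then have "{\<omega> \<in> space S. \<forall>u\<in>{..<n}. \<forall>v\<in>{..<n}. long_edge d N r n \<omega> u v \<longrightarrow>
        real (edge_clique_number {..<n} (?E \<omega>) u v) \<le> B} \<in> sets S"
      by (intro sets.sets_Collect_finite_All) auto
    then show ?thesis
      by (simp only: Ball_def lessThan_iff)
  qed
  have integral_indicator_add: "(\<integral>\<^sup>+x. indicator D x + c \<partial>?X) = emeasure ?X D + c"
    if "D \<in> sets ?X" for D and c :: ennreal
    using that by (simp add: nn_integral_add X.emeasure_space_1)
  have "emeasure S ?bad = (\<integral>\<^sup>+x. emeasure ?Y (Pair x -` ?bad) \<partial>?X)"
    using bad unfolding S by (rule Y.emeasure_pair_measure_alt)
  \<comment> \<open>Integrate over the points last. If \<open>x\<close> has a vertex of large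
    degree, the conditional probability is bounded by 1; otherwise the coin bound applies to the
    section at \<open>x\<close>.\<close>
  also have "\<dots> \<le> (\<integral>\<^sup>+x. indicator ?dense x + ennreal (real n ^ (2 * m) * q ^ (m * m)) \<partial>?X)"
  proof (rule nn_integral_mono)
    fix x assume x: "x \<in> space ?X"
    show "emeasure ?Y (Pair x -` ?bad) \<le> indicator ?dense x + ennreal (real n ^ (2 * m) * q ^ (m * m))"
    proof (cases "x \<in> ?dense")
      case True
      then have "indicator ?dense x = (1 :: ennreal)"
        by (rule indicator_simps(1))
      then show ?thesis
        by (simp only:) (intro add_increasing2 zero_le Y.emeasure_le_1)
    next
      case False
      with x have "card {j. {i, j} \<in> rgg d N r n x} < m" if "i < n" for i
        using that by force
      from coins_clique_bound[OF q this]
      have "emeasure ?Y {b \<in> space ?Y. \<exists>K\<in>nsets {..<n} (2 * m). clique K (?E (x, b))}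
          \<le> ennreal (real n ^ (2 * m) * q ^ (m * m))" .
      moreover have "Pair x -` ?bad = {b \<in> space ?Y. \<exists>K\<in>nsets {..<n} (2 * m). clique K (?E (x, b))}"
        using x by (auto simp: S space_pair_measure)
      ultimately show ?thesis
        using False by simp
    qed
  qed
  also have "\<dots> = emeasure ?X ?dense + ennreal (real n ^ (2 * m) * q ^ (m * m))"
    by (rule integral_indicator_add[OF dense])
  also have "\<dots> \<le> ennreal (real n * (real (n choose m) * p ^ m)) + ennreal (real n ^ (2 * m) * q ^ (m * m))"
  proof (rule add_right_mono)
    show "emeasure ?X ?dense \<le> ennreal (real n * (real (n choose m) * p ^ m))"
      by (rule large_degree_bound[OF N \<nu> \<open>prob_space \<nu>\<close> p p0])
  qed
  also have "\<dots> = ennreal (real n * (real (n choose m) * p ^ m) + real n ^ (2 * m) * q ^ (m * m))"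
    using p0 q by simp
  finally have "measure S ?bad \<le> real n * (real (n choose m) * p ^ m) + real n ^ (2 * m) * q ^ (m * m)"
    using p0 q by (simp add: S.emeasure_eq_measure flip: ennreal_plus)
  moreover have "measure S (space S - ?bad) = 1 - measure S ?bad"
    using bad by (rule S.prob_compl)
  \<comment> \<open>Subsets of cliques are cliques, so a clique with more than \<open>2 * m\<close>
    vertices would contain one with exactly \<open>2 * m\<close>, which is excluded outside
    \<open>?bad\<close>.\<close>
  moreover have "measure S (space S - ?bad) \<le> measure S ?good"
  proof (rule S.finite_measure_mono[OF _ good], rule subsetI)
    fix \<omega> assume \<omega>: "\<omega> \<in> space S - ?bad"
    have "edge_clique_number {..<n} (?E \<omega>) u v \<le> 2 * m"
      if uv: "u < n" "v < n" "long_edge d N r n \<omega> u v" for u v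
    proof -
      let ?C = "{card K | K. K \<subseteq> {..<n} \<and> clique K (?E \<omega>) \<and> u \<in> K \<and> v \<in> K}"
      have "finite ?C"
        by (rule finite_subset[of _ "card ` Pow {..<n}"]) auto
      \<comment> \<open>The endpoints of an edge form a clique, so the maximum defining the edge
        clique number is taken over a nonempty set.\<close>
      moreover have "card {u, v} \<in> ?C"
        using uv by (auto simp: long_edge_def clique_def insert_commute)
      then have "?C \<noteq> {}"
        by blast
      moreover have "k \<le> 2 * m" if "k \<in> ?C" for k
      proof (rule ccontr)
        assume "\<not> k \<le> 2 * m"
        with that obtain K where K: "K \<subseteq> {..<n}" "clique K (?E \<omega>)" "2 * m \<le> card K"
          by auto
        from obtain_subset_with_card_n[OF K(3)] obtain L where L: "L \<subseteq> K" "card L = 2 * m" "finite L"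
          by metis
        with K have "L \<in> nsets {..<n} (2 * m)" "clique L (?E \<omega>)"
          by (auto simp: nsets_def clique_def)
        with \<omega> show False
          by blast
      qed
      ultimately show ?thesis
        unfolding edge_clique_number_def by (intro Max.boundedI)
    qed
    then have "real (edge_clique_number {..<n} (?E \<omega>) u v) \<le> B"
      if "u < n" "v < n" "long_edge d N r n \<omega> u v" for u v
      using that B by (meson of_nat_mono order_trans)
    with \<omega> show "\<omega> \<in> ?good"
      by blast
  qed
  moreover have "measure S ?good \<le> 1"
    by (rule S.prob_le_1)
  ultimately show "\<bar>measure S ?good - 1\<bar> \<le> real n * (real (n choose m) * p ^ m) + real n ^ (2 * m) * q ^ (m * m)"
    by linarith
qed

section \<open>Asymptotics\<close>

text \<open>The left side divided by \<open>fact m\<close> is a single term of the exponential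
  series at \<open>m\<close>. This is the weak Stirling bound that turns \<open>n choose m\<close>
  into a power.\<close>

lemma power_le_fact_exp: "real m ^ m \<le> fact m * exp (real m)"
proof -
  have "(\<Sum>k\<in>{m}. real m ^ k /\<^sub>R fact k) \<le> exp (real m)"
    unfolding exp_def by (intro sum_le_suminf summable_exp_generic) auto
  then show ?thesis
    by (simp add: field_simps)
qed

lemma choose_mult_power_le:
  assumes "0 \<le> p" "0 < m"
  shows "real (n choose m) * p ^ m \<le> (exp 1 * (real n * p) / real m) ^ m"
proof -
  have "real (n choose m) * fact m \<le> real n ^ m"
    using of_nat_mono[OF binomial_fact_pow[of n m], where 'a = real] by simp
  then have "real (n choose m) * real m ^ m \<le> real n ^ m * exp (real m)"
  proof -
    have "real (n choose m) * real m ^ m \<le> real (n choose m) * fact m * exp (real m)"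
      using mult_left_mono[OF power_le_fact_exp[of m], of "real (n choose m)"] by (simp add: mult.assoc)
    also have "\<dots> \<le> real n ^ m * exp (real m)"
      using \<open>real (n choose m) * fact m \<le> real n ^ m\<close> by (intro mult_right_mono) auto
    finally show ?thesis .
  qed
  then have "real (n choose m) \<le> real n ^ m * exp (real m) / real m ^ m"
    using assms by (simp add: field_simps)
  then have "real (n choose m) * p ^ m \<le> real n ^ m * exp (real m) / real m ^ m * p ^ m"
    using assms by (intro mult_right_mono) auto
  also have "\<dots> = (exp 1 * (real n * p) / real m) ^ m"
    by (simp add: power_mult_distrib power_divide mult_ac flip: exp_of_nat_mult)
  finally show ?thesis .
qed

text \<open>With \<open>T = ln n / ln (1 / \<rho>)\<close> we have \<open>\<rho> powr T = 1 / n\<close>, so the assumption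
  \<open>m \<ge> C * T\<close> makes \<open>\<rho> ^ m\<close> at most \<open>n powr - C\<close>.\<close>

schematic_goal failure_probability_le:
  fixes n m :: nat
  assumes n: "n \<ge> 3" and \<rho>: "0 < \<rho>" "\<rho> < 1" and q: "0 \<le> q" "q \<le> \<rho>"
    and A: "0 \<le> A" "A / ln (real n) \<le> \<rho>" and p: "0 \<le> p" "real n * p \<le> \<kappa> * A" and \<kappa>: "0 \<le> \<kappa>"
    and C: "C \<ge> 4" "C \<ge> 2 * exp 1 * \<kappa>" and m: "C * (ln (real n) / ln (1 / \<rho>)) \<le> real m"
  shows "real n * (real (n choose m) * p ^ m) + real n ^ (2 * m) * q ^ (m * m) \<le> ?c / real n"
proof -
  let ?L = "ln (real n)" and ?s = "ln (1 / \<rho>)"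
  have L: "?L > 0"
    using n by simp
  have s: "?s > 0"
    using \<rho> by simp
  have ms: "C * ?L \<le> real m * ?s"
    using m s by (simp add: field_simps)
  have "0 < C * (?L / ?s)"
    using C L s by simp
  with m have m0: "m > 0"
    using of_nat_0_less_iff order_less_le_trans by blast
  \<comment> \<open>Used with \<open>t = 1/2\<close> for the degrees and with \<open>t = 1\<close>
    for the coins.\<close>
  have m_powr: "(\<rho> powr t) ^ m \<le> real n powr - (C * t)" if "t \<ge> 0" for t
  proof -
    have "(\<rho> powr t) ^ m = exp (- (real m * ?s * t))"
      using \<rho> by (simp add: powr_def ln_div mult_ac flip: exp_of_nat_mult)
    also have "\<dots> \<le> exp (- (C * ?L * t))"
      using ms that by (simp add: mult_right_mono)
    also have "\<dots> = real n powr - (C * t)"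
      using n by (simp add: powr_def mult_ac)
    finally show ?thesis .
  qed
  have "real n * (real (n choose m) * p ^ m) \<le> 1 / real n"
  proof -
    \<comment> \<open>The logarithm is at most twice the square root, so the factor
      \<open>?s\<close> costs only half a power of \<open>\<rho>\<close>.\<close>
    have "?s \<le> 2 * \<rho> powr - (1/2)"
    proof -
      have "ln ((1 / \<rho>) powr (1/2)) \<le> (1 / \<rho>) powr (1/2) - 1"
        using \<rho> by (intro ln_le_minus_one) auto
      moreover have "ln ((1 / \<rho>) powr (1/2)) = ?s / 2"
        using \<rho> by (simp add: ln_powr)
      moreover have "(1 / \<rho>) powr (1/2) = \<rho> powr - (1/2)"
        using \<rho> by (simp add: powr_divide powr_minus_divide)
      ultimately show ?thesis
        by linarith
    qed
    have "exp 1 * (real n * p) / real m \<le> exp 1 * (\<kappa> * A) / (C * (?L / ?s))"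
      using p m \<open>0 < C * (?L / ?s)\<close> A \<kappa> by (intro frac_le) auto
    also have "\<dots> = exp 1 * \<kappa> / C * (A / ?L * ?s)"
      using L s C by (simp add: field_simps)
    \<comment> \<open>The three factors are bounded separately:
      \<open>C \<ge> 2 * exp 1 * \<kappa>\<close> gives \<open>1/2\<close>, the hypothesis on
      \<open>A\<close> gives \<open>\<rho>\<close>, and the square-root bound handles
      \<open>?s\<close>. Half a power of \<open>\<rho>\<close> survives.\<close>
    also have "\<dots> \<le> (1/2) * (\<rho> * (2 * \<rho> powr - (1/2)))"
      using A \<rho> L s C \<kappa> \<open>?s \<le> 2 * \<rho> powr - (1/2)\<close>
      by (intro mult_mono) (auto simp: field_simps)
    also have "\<dots> = \<rho> powr (1/2)"
      using \<rho> powr_add[of \<rho> 1 "- (1/2)"] by simp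
    finally have "(exp 1 * (real n * p) / real m) ^ m \<le> (\<rho> powr (1/2)) ^ m"
      using p by (intro power_mono) auto
    with choose_mult_power_le[OF p(1) m0, of n] m_powr[of "1/2"]
    have "real (n choose m) * p ^ m \<le> real n powr - (C / 2)"
      by simp
    \<comment> \<open>Here \<open>C \<ge> 4\<close> is used; the factor \<open>n\<close> for the
      choice of the vertex then leaves \<open>1 / n\<close>.\<close>
    also have "\<dots> \<le> real n powr - 2"
      using C n by (intro powr_mono) auto
    also have "\<dots> = 1 / (real n * real n)"
      using n by (simp add: powr_minus_divide power2_eq_square)
    finally show ?thesis
      using n by (simp add: field_simps)
  qed
  moreover have "real n ^ (2 * m) * q ^ (m * m) \<le> 1 / real n"
  proof -
    have "q ^ m \<le> (\<rho> powr 1) ^ m"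
      using q \<rho> by (intro power_mono) auto
    also have "\<dots> \<le> real n powr - C"
      using m_powr[of 1] by simp
    also have "\<dots> \<le> real n powr - 3"
      using C n by (intro powr_mono) auto
    also have "\<dots> = 1 / real n ^ 3"
      using n by (simp add: powr_minus_divide)
    \<comment> \<open>The coin term equals \<open>(n^2 * q^m)^m\<close>. Its base is at most
      \<open>1 / n\<close>, and since \<open>m > 0\<close> the outer power cannot increase
      this.\<close>
    finally have "real n ^ 2 * q ^ m \<le> real n ^ 2 * (1 / real n ^ 3)"
      by (intro mult_left_mono) auto
    also have "\<dots> = 1 / real n"
      using n by (simp add: power2_eq_square power3_eq_cube)
    finally have "(real n ^ 2 * q ^ m) ^ m \<le> (1 / real n) ^ m"
      using q by (intro power_mono) auto
    also have "\<dots> \<le> (1 / real n) ^ 1"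
      using n m0 by (intro power_decreasing) auto
    finally show ?thesis
      by (simp add: power_mult_distrib power_mult)
  qed
  ultimately show "real n * (real (n choose m) * p ^ m) + real n ^ (2 * m) * q ^ (m * m) \<le> 2 / real n"
    by simp
qed

section \<open>Uniform estimate and passage to the limit\<close>

text \<open>The order of quantifiers is the point: \<open>C\<close> depends on the norm and the law
  alone, so one constant serves all \<open>n\<close> when \<open>r\<close>, \<open>q\<close> and
  \<open>\<rho>\<close> vary with \<open>n\<close>.\<close>

lemma long_edges_bounded_probability:
  assumes N: "is_norm d N" and d: "d \<ge> 1" and P: "prob_space \<nu>" and dens: "has_bounded_density d \<nu>"
  shows "\<exists>C. \<forall>n r q \<rho>. n \<ge> 3 \<and> 0 < r \<and> 0 \<le> q \<and> q \<le> \<rho> \<and> 0 < \<rho> \<and> \<rho> < 1 \<and>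
    real n * r ^ d / ln (real n) \<le> \<rho> \<and> ln (real n) / ln (1 / \<rho>) \<ge> 1 \<longrightarrow>
    \<bar>measure (perturbed_space \<nu> q n) {\<omega> \<in> space (perturbed_space \<nu> q n).
        \<forall>u<n. \<forall>v<n. long_edge d N r n \<omega> u v \<longrightarrow>
          real (edge_clique_number {..<n} (perturbed_rgg d N r n \<omega>) u v)
            \<le> C * (ln (real n) / ln (1 / \<rho>))} - 1\<bar> \<le> 2 / real n"
proof -
  have \<nu>: "sets \<nu> = sets (leb d)"
    using dens by (auto simp: has_bounded_density_def)
  obtain \<kappa> where \<kappa>: "\<kappa> \<ge> 0" and ball: "\<And>y r. y \<in> Rd d \<Longrightarrow> r \<ge> 0 \<Longrightarrow>
      emeasure \<nu> (closed_ball d N y r) \<le> ennreal (\<kappa> * r ^ d)"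
    using bounded_density_ball[OF N d dens] by blast
  define C where "C = max 4 (2 * exp 1 * \<kappa>)"
  have C: "C \<ge> 4" "C \<ge> 2 * exp 1 * \<kappa>"
    by (simp_all add: C_def)
  show ?thesis
  \<comment> \<open>Rounding gives \<open>m \<le> C * ?T + 1\<close>, hence
    \<open>2 * m \<le> 2 * C * ?T + 2\<close>, and \<open>?T \<ge> 1\<close> absorbs the additive 2
    into the constant.\<close>
  proof (rule exI[of _ "2 * C + 2"], intro allI impI, elim conjE)
    fix n :: nat and r q \<rho> :: real
    let ?T = "ln (real n) / ln (1 / \<rho>)"
    assume n: "n \<ge> 3" and r: "0 < r" and q: "0 \<le> q" "q \<le> \<rho>" and \<rho>: "0 < \<rho>" "\<rho> < 1"
      and A: "real n * r ^ d / ln (real n) \<le> \<rho>" and T: "?T \<ge> 1"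
    define m where "m = nat \<lceil>C * ?T\<rceil>"
    have "C * ?T \<ge> 0"
      using C T by (intro mult_nonneg_nonneg) linarith+
    then have m: "C * ?T \<le> real m" "real m \<le> C * ?T + 1"
      unfolding m_def by linarith+
    have "(2 * C + 2) * ?T = 2 * (C * ?T) + 2 * ?T"
      by (simp only: distrib_right mult.assoc)
    with m(2) T have B: "real (2 * m) \<le> (2 * C + 2) * ?T"
      by linarith
    have ball_r: "emeasure \<nu> (closed_ball d N y r) \<le> ennreal (\<kappa> * r ^ d)" if "y \<in> Rd d" for y
      using that r by (intro ball) auto
    have p: "0 \<le> \<kappa> * r ^ d"
      using \<kappa> r by simp
    have "q \<le> 1"
      using q \<rho> by linarith
    have "\<bar>measure (perturbed_space \<nu> q n) {\<omega> \<in> space (perturbed_space \<nu> q n).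
        \<forall>u<n. \<forall>v<n. long_edge d N r n \<omega> u v \<longrightarrow>
          real (edge_clique_number {..<n} (perturbed_rgg d N r n \<omega>) u v) \<le> (2 * C + 2) * ?T} - 1\<bar>
      \<le> real n * (real (n choose m) * (\<kappa> * r ^ d) ^ m) + real n ^ (2 * m) * q ^ (m * m)"
      by (rule measure_long_edges_bounded[OF N \<nu> P ball_r p q(1) \<open>q \<le> 1\<close> B])
    also have "\<dots> \<le> 2 / real n"
    proof (rule failure_probability_le[OF n \<rho> q _ A p _ \<kappa> C m(1)])
      show "0 \<le> real n * r ^ d"
        using r by simp
      show "real n * (\<kappa> * r ^ d) \<le> \<kappa> * (real n * r ^ d)"
        by (simp only: mult.left_commute order_refl)
    qed
    finally show "\<bar>measure (perturbed_space \<nu> q n) {\<omega> \<in> space (perturbed_space \<nu> q n).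
        \<forall>u<n. \<forall>v<n. long_edge d N r n \<omega> u v \<longrightarrow>
          real (edge_clique_number {..<n} (perturbed_rgg d N r n \<omega>) u v) \<le> (2 * C + 2) * ?T} - 1\<bar>
      \<le> 2 / real n" .
  qed
qed

\<comment> \<open>The proof picks the exponent \<open>1/2\<close>; an exponent below 1 leaves room
  for the logarithm when \<open>A / ln n\<close> is compared with \<open>1 / n\<close>.\<close>
schematic_goal intermediate_regime_lower_bound:
  assumes "intermediate_regime d r"
  shows "\<forall>\<^sub>F n in sequentially. real n powr - ?\<epsilon> / (real n * r n ^ d) < 1"
proof -
  have "(\<lambda>n. real n powr - (1/2) / (real n * r n ^ d)) \<longlonglongrightarrow> 0"
    using assms unfolding intermediate_regime_def much_less_def by (metis half_gt_zero zero_less_one)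
  then show "\<forall>\<^sub>F n in sequentially. real n powr - (1/2) / (real n * r n ^ d) < 1"
    by (rule order_tendstoD) simp
qed

text \<open>Common form of both parts, with \<open>\<rho>\<close> standing for the ratio
  \<open>n * r^d / ln n\<close> or for \<open>q\<close>. Under these hypotheses the uniform estimate
  applies to all large \<open>n\<close>, with an error that tends to 0.\<close>

lemma whp_long_edges_bounded_log:
  assumes std: "standard_setting d N \<nu> r q" and reg: "intermediate_regime d r"
    and \<rho>: "\<forall>\<^sub>F n in sequentially. real n * r n ^ d / ln (real n) \<le> \<rho> n \<and> q n \<le> \<rho> n \<and> \<rho> n < 1"
  shows "\<exists>C. whp_long_edges_bounded d N \<nu> r q (\<lambda>n. C * (ln (real n) / ln (1 / \<rho> n)))"
proof -
  have d: "d \<ge> 1" and N: "is_norm d N" and P: "prob_space \<nu>" and dens: "has_bounded_density d \<nu>"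
    and r: "\<And>n. r n > 0" and q: "\<And>n. 0 \<le> q n"
    using std by (auto simp: standard_setting_def)
  define p where "p C n = measure (perturbed_space \<nu> (q n) n)
        {\<omega> \<in> space (perturbed_space \<nu> (q n) n).
           \<forall>u<n. \<forall>v<n. long_edge d N (r n) n \<omega> u v \<longrightarrow>
             real (edge_clique_number {..<n} (perturbed_rgg d N (r n) n \<omega>) u v)
               \<le> C * (ln (real n) / ln (1 / \<rho> n))}" for C n
  obtain C where C: "\<bar>p C n - 1\<bar> \<le> 2 / real n"
    if "n \<ge> 3 \<and> 0 < r n \<and> 0 \<le> q n \<and> q n \<le> \<rho> n \<and> 0 < \<rho> n \<and> \<rho> n < 1 \<and>
      real n * r n ^ d / ln (real n) \<le> \<rho> n \<and> ln (real n) / ln (1 / \<rho> n) \<ge> 1" for n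
    using long_edges_bounded_probability[OF N d P dens] unfolding p_def by blast
  have "\<forall>\<^sub>F n in sequentially. real n powr - (1/2) / (real n * r n ^ d) < 1"
    using reg by (rule intermediate_regime_lower_bound)
  moreover have "\<forall>\<^sub>F n in sequentially. ln (real n) / real n \<le> real n powr - (1/2)"
    by real_asymp
  moreover have "\<forall>\<^sub>F n in sequentially. n \<ge> (3::nat)"
    by (rule eventually_ge_at_top)
  ultimately have "\<forall>\<^sub>F n in sequentially. norm (p C n - 1) \<le> 2 / real n"
    using \<rho>
  proof eventually_elim
    case (elim n)
    let ?A = "real n * r n ^ d"
    have n: "n \<ge> 3" and L: "ln (real n) > 0"
      using elim by auto
    have A: "?A > 0"
      using r n by simp
    with L have \<rho>0: "0 < \<rho> n"
      using elim by (meson divide_pos_pos less_le_trans)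
    \<comment> \<open>From \<open>?A > n powr - (1/2) \<ge> ln n / n\<close> follows
      \<open>\<rho> n \<ge> ?A / ln n \<ge> 1 / n\<close>. This says
      \<open>ln (1 / \<rho> n) \<le> ln n\<close>, the condition that absorbs the rounding.\<close>
    have "1 / real n \<le> \<rho> n"
    proof -
      have "real n powr - (1/2) < ?A"
        using elim(1) A by (simp only: pos_divide_less_eq mult_1)
      with elim(2) have "ln (real n) / real n \<le> ?A"
        by linarith
      with L n have "1 / real n \<le> ?A / ln (real n)"
        by (simp add: field_simps)
      with elim show ?thesis
        by linarith
    qed
    then have "1 / \<rho> n \<le> real n"
      using \<rho>0 n by (simp add: field_simps)
    then have "ln (1 / \<rho> n) \<le> ln (real n)"
      using \<rho>0 n by (subst ln_le_cancel_iff) auto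
    moreover have "ln (1 / \<rho> n) > 0"
      using elim \<rho>0 by simp
    ultimately have "ln (real n) / ln (1 / \<rho> n) \<ge> 1"
      by simp
    with elim n \<rho>0 q r show ?case
      unfolding real_norm_def by (intro C) blast
  qed
  moreover have "(\<lambda>n. 2 / real n) \<longlonglongrightarrow> 0"
    by real_asymp
  ultimately have "(\<lambda>n. p C n - 1) \<longlonglongrightarrow> 0"
    by (rule Lim_null_comparison)
  then have "p C \<longlonglongrightarrow> 1"
    by (rule LIM_zero_cancel)
  then show ?thesis
    unfolding whp_long_edges_bounded_def p_def by blast
qed

theorem theorem3p13:
  fixes \<beta> :: nat
  shows
    "(\<exists>C\<^sub>1>0. \<exists>C\<^sub>2>0. \<forall>d N \<nu> r q.
        standard_setting d N \<nu> r q \<longrightarrow> besicovitch_constant d N \<beta> \<longrightarrow> intermediate_regime d r \<longrightarrow>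
        (\<forall>\<^sub>F n in sequentially. q n \<le> C\<^sub>1 * (real n * r n ^ d / ln (real n)) powr C\<^sub>2) \<longrightarrow>
        (\<exists>C. whp_long_edges_bounded d N \<nu> r q
               (\<lambda>n. C * (ln (real n) / ln (ln (real n) / (real n * r n ^ d))))))
     \<and>
     (\<exists>\<xi>>0. \<forall>d N \<nu> r q.
        standard_setting d N \<nu> r q \<longrightarrow> besicovitch_constant d N \<beta> \<longrightarrow> intermediate_regime d r \<longrightarrow>
        (\<forall>\<^sub>F n in sequentially. (real n * r n ^ d / ln (real n)) powr \<xi> \<le> q n \<and> q n < 1) \<longrightarrow>
        (\<exists>C. whp_long_edges_bounded d N \<nu> r q (\<lambda>n. C * log (1 / q n) (real n))))"
proof (intro conjI)
  \<comment> \<open>Nonnegativity of the ratio is what allows \<open>powr 1\<close> to be removed in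
    both parts.\<close>
  have ratio_nonneg: "\<forall>\<^sub>F n in sequentially. 0 \<le> real n * r n ^ d / ln (real n)"
    if "standard_setting d N \<nu> r q" for d N \<nu> r q
    using eventually_ge_at_top[of 1]
  proof eventually_elim
    case (elim n)
    have "r n > 0"
      using that by (simp add: standard_setting_def)
    with elim show ?case
      by simp
  qed
  show "\<exists>C\<^sub>1>0. \<exists>C\<^sub>2>0. \<forall>d N \<nu> r q.
        standard_setting d N \<nu> r q \<longrightarrow> besicovitch_constant d N \<beta> \<longrightarrow> intermediate_regime d r \<longrightarrow>
        (\<forall>\<^sub>F n in sequentially. q n \<le> C\<^sub>1 * (real n * r n ^ d / ln (real n)) powr C\<^sub>2) \<longrightarrow>
        (\<exists>C. whp_long_edges_bounded d N \<nu> r q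
               (\<lambda>n. C * (ln (real n) / ln (ln (real n) / (real n * r n ^ d)))))"
  proof (rule exI[of _ 1], rule conjI[OF zero_less_one], rule exI[of _ 1],
      rule conjI[OF zero_less_one], intro allI impI)
    fix d N \<nu> r q
    assume std: "standard_setting d N \<nu> r q" and reg: "intermediate_regime d r"
      and q: "\<forall>\<^sub>F n in sequentially. q n \<le> 1 * (real n * r n ^ d / ln (real n)) powr 1"
    have "(\<lambda>n. real n * r n ^ d / ln (real n)) \<longlonglongrightarrow> 0"
      using reg by (simp add: intermediate_regime_def much_less_def)
    then have "\<forall>\<^sub>F n in sequentially. real n * r n ^ d / ln (real n) < 1"
      by (rule order_tendstoD) simp
    \<comment> \<open>Part (a) takes the ratio itself as \<open>\<rho>\<close>; it is eventually
      below 1 by the upper end of the regime.\<close>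
    with q ratio_nonneg[OF std]
    have "\<forall>\<^sub>F n in sequentially. real n * r n ^ d / ln (real n) \<le> real n * r n ^ d / ln (real n) \<and>
        q n \<le> real n * r n ^ d / ln (real n) \<and> real n * r n ^ d / ln (real n) < 1"
      by eventually_elim (simp add: powr_one)
    from whp_long_edges_bounded_log[OF std reg this]
    show "\<exists>C. whp_long_edges_bounded d N \<nu> r q
               (\<lambda>n. C * (ln (real n) / ln (ln (real n) / (real n * r n ^ d))))"
      by simp
  qed
  show "\<exists>\<xi>>0. \<forall>d N \<nu> r q.
        standard_setting d N \<nu> r q \<longrightarrow> besicovitch_constant d N \<beta> \<longrightarrow> intermediate_regime d r \<longrightarrow>
        (\<forall>\<^sub>F n in sequentially. (real n * r n ^ d / ln (real n)) powr \<xi> \<le> q n \<and> q n < 1) \<longrightarrow>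
        (\<exists>C. whp_long_edges_bounded d N \<nu> r q (\<lambda>n. C * log (1 / q n) (real n)))"
  proof (rule exI[of _ 1], rule conjI[OF zero_less_one], intro allI impI)
    fix d N \<nu> r q
    assume std: "standard_setting d N \<nu> r q" and reg: "intermediate_regime d r"
      and q: "\<forall>\<^sub>F n in sequentially. (real n * r n ^ d / ln (real n)) powr 1 \<le> q n \<and> q n < 1"
    \<comment> \<open>Part (b) takes \<open>\<rho> = q\<close>, and then
      \<open>ln n / ln (1 / q)\<close> is the logarithm of \<open>n\<close> to base
      \<open>1 / q\<close>.\<close>
    from q ratio_nonneg[OF std]
    have "\<forall>\<^sub>F n in sequentially. real n * r n ^ d / ln (real n) \<le> q n \<and> q n \<le> q n \<and> q n < 1"
      by eventually_elim (simp only: powr_one order_refl simp_thms)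
    from whp_long_edges_bounded_log[OF std reg this]
    show "\<exists>C. whp_long_edges_bounded d N \<nu> r q (\<lambda>n. C * log (1 / q n) (real n))"
      by (simp add: log_def)
  qed
qed

end
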